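(* Let $p$ be an odd prime number and $n\geq 3$ an integer. Let $N$ be a nonabelian group of order $p^n$ whose commutator subgroup $[N,N]$ has order $p$, and let $A$ be an abelian group of order $p^n$ having the same number of elements of order $p^m$ as $N$ for every $1\leq m\leq n$. Let $G$ be a group and $G'\subset G$ a subgroup with $[G:G']=p^n$. If the pair $(G,N)$ is realizable (with respect to $G'$), then the pair $(G,A)$ is realizable (with respect to $G'$).
   Context: For a finite group $N$ with identity $e_N$, the holomorph $\mathrm{Hol}(N)$ is the normalizer in $\mathrm{Sym}(N)$ of the image of the left regular representation $\lambda_N:N\to \mathrm{Sym}(N)$. As an abstract group, $\mathrm{Hol}(N)=N\rtimes\mathrm{Aut}(N)$, with product $(x,\varphi)(y,\psi)=(x\varphi(y),\varphi\psi)$, and $(x,\varphi)$ acts on $N$ by $y\mapsto x\varphi(y)$. Let $G$ be a finite group, $G'\subset G$ a subgroup, and $N$ a group of order $[G:G']$. The pair $(G,N)$ is called realizable (with respect to $G'$) if there exists a group monomorphism $\beta:G\hookrightarrow \mathrm{Hol}(N)$ such that $\beta(G')$ is the stabilizer of $e_N$ in $\beta(G)$. (By theorems of Greither–Pareigis, Childs and Byott, this is equivalent to the following: a separable field extension $L/K$ of degree $|N|$ with normal closure $\widetilde L$, $\mathrm{Gal}(\widetilde L/K)\simeq G$ and $\mathrm{Gal}(\widetilde L/L)$ corresponding to $G'$, has a Hopf Galois structure of type $N$. Here a Hopf Galois structure on $L/K$ corresponds to a regular subgroup of $\mathrm{Sym}(G/G')$ normalized by the image of $G$ acting by left translation on $G/G'$,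 and its type is the isomorphism class of that regular subgroup.) *)

theory Defs
  imports "HOL-Algebra.Algebra" "HOL-Computational_Algebra.Primes"
begin

text \<open>The permutation group of a carrier set is the library's \<^const>\<open>BijGroup\<close>, whose elements are
  bijections that are \<^const>\<open>undefined\<close> outside the carrier; hence the restricted abstraction here.\<close>

definition left_regular :: "('a, 'b) monoid_scheme \<Rightarrow> 'a \<Rightarrow> ('a \<Rightarrow> 'a)" where
  "left_regular N x = (\<lambda>y \<in> carrier N. x \<otimes>\<^bsub>N\<^esub> y)"

definition Hol :: "('a, 'b) monoid_scheme \<Rightarrow> ('a \<Rightarrow> 'a) monoid" where
  "Hol N = (BijGroup (carrier N))
     \<lparr>carrier := normalizer (BijGroup (carrier N)) (left_regular N ` carrier N)\<rparr>"

text \<open>Elements of the holomorph are functions, so its action on \<open>N\<close> is the identity map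
  \<^const>\<open>id\<close>.\<close>

definition realizable ::
  "('g, 'c) monoid_scheme \<Rightarrow> 'g set \<Rightarrow> ('a, 'b) monoid_scheme \<Rightarrow> bool" where
  "realizable G H N \<longleftrightarrow>
     group G \<and> finite (carrier G) \<and> subgroup H G \<and>
     group N \<and> order N = card (rcosets\<^bsub>G\<^esub> H) \<and>
     (\<exists>\<beta> \<in> mon G (Hol N).
        \<beta> ` H = stabilizer ((Hol N)\<lparr>carrier := \<beta> ` carrier G\<rparr>) id \<one>\<^bsub>N\<^esub>)"

end

theory Submission
  imports Defs "HOL-Number_Theory.Residues"
begin

text \<open>
  The proof rests on the Baer correspondence. Since the derived subgroup of \<open>N\<close> has prime order
  \<open>p\<close> and is normal in a \<open>p\<close>-group, it is central; as \<open>p\<close> is odd, commutators have unique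
  square roots in it. Hence \<open>x \<circ> y = x y [y,x]^{1/2}\<close> is an abelian group operation on the set \<open>N\<close>.
  It has the same identity and the same powers as \<open>N\<close>, so the same element orders.

  The point is that \<open>Hol N\<close> and \<open>Hol (N, \<circ>)\<close> are subgroups of one and the same symmetric group,
  and that the first is contained in the second: automorphisms of \<open>N\<close> preserve \<open>\<circ>\<close>, and left
  multiplication by \<open>a\<close> in \<open>N\<close> is \<open>y \<mapsto> a \<circ> (y [y,a]^{-1/2})\<close>, where
  \<open>y \<mapsto> y [y,a]^{-1/2}\<close> is an automorphism of \<open>(N, \<circ>)\<close> because commutators are bimultiplicative
  (\<open>Hol_subset_Hol_baer\<close>). An embedding of \<open>G\<close> in \<open>Hol N\<close> is therefore also one in
  \<open>Hol (N, \<circ>)\<close>, and since the two groups share their identity element the stabilizer condition is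
  literally the same. So \<open>(G, (N, \<circ>))\<close> is realizable.

  It remains to see that \<open>A\<close> is isomorphic to \<open>(N, \<circ>)\<close>. Both are abelian of order \<open>p^n\<close> with the
  same number of elements of each order, and such groups are isomorphic
  (\<open>abelian_p_groups_iso_if_same_orders\<close>): a cyclic subgroup of maximal order is a direct factor,
  that maximal order can be read off from the counts, and the counts of the complement are the
  quotients of those of the group by those of the cyclic factor, so induction applies.
\<close>

section \<open>The holomorph as the group of affine bijections\<close>

lemma (in group) conjugate_set_eq_iff:
  assumes "S \<subseteq> carrier G" "g \<in> carrier G"
  shows "g <# S #> inv g = S \<longleftrightarrow> g <# S = S #> g"
proof
  assume eq: "g <# S #> inv g = S"
  have gS: "g <# S \<subseteq> carrier G"
    using assms by (simp add: l_coset_subset_G)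
  have "S #> g = g <# S #> inv g #> g"
    by (simp add: eq)
  also have "\<dots> = g <# S"
    using gS assms by (simp add: coset_mult_assoc coset_mult_one)
  finally show "g <# S = S #> g" by simp
next
  assume "g <# S = S #> g"
  then show "g <# S #> inv g = S"
    using assms by (simp add: coset_mult_assoc coset_mult_one)
qed

lemma left_regular_in_Bij:
  assumes "group N" "x \<in> carrier N"
  shows "left_regular N x \<in> Bij (carrier N)"
proof -
  interpret group N by fact
  have "bij_betw (\<lambda>y. x \<otimes>\<^bsub>N\<^esub> y) (carrier N) (carrier N)"
    by (rule bij_betw_byWitness[where f' = "\<lambda>y. inv\<^bsub>N\<^esub> x \<otimes>\<^bsub>N\<^esub> y"])
      (use assms in \<open>auto simp: m_assoc[symmetric]\<close>)
  then show ?thesis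
    by (auto simp: left_regular_def Bij_def cong: bij_betw_cong)
qed

text \<open>If \<open>f\<close> normalizes the left translations, then \<open>f\<close> carries translation by \<open>x\<close> to translation by
  some \<open>z\<close>, and evaluating at the identity gives \<open>z = f x (f 1)\<^sup>-\<^sup>1\<close>. So the holomorph consists of the
  bijections preserving the ternary operation \<open>x y\<^sup>-\<^sup>1 z\<close>. This intrinsic form replaces the
  normalizer in all comparisons of holomorphs below.\<close>
lemma carrier_Hol:
  assumes "group N"
  shows "carrier (Hol N) = {f \<in> Bij (carrier N).
    \<forall>x\<in>carrier N. \<forall>y\<in>carrier N. f (x \<otimes>\<^bsub>N\<^esub> y) = f x \<otimes>\<^bsub>N\<^esub> inv\<^bsub>N\<^esub> (f \<one>\<^bsub>N\<^esub>) \<otimes>\<^bsub>N\<^esub> f y}"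
    (is "_ = ?A")
proof -
  interpret N: group N by fact
  let ?P = "BijGroup (carrier N)"
  let ?L = "left_regular N ` carrier N"
  interpret P: group ?P by (rule group_BijGroup)
  have carrP: "carrier ?P = Bij (carrier N)"
    by (simp add: BijGroup_def)
  have L: "?L \<subseteq> carrier ?P"
    using left_regular_in_Bij[OF assms] by (auto simp: carrP)
  have mem: "f \<in> carrier (Hol N) \<longleftrightarrow> f \<in> Bij (carrier N) \<and> f <#\<^bsub>?P\<^esub> ?L = ?L #>\<^bsub>?P\<^esub> f" for f
    using L P.conjugate_set_eq_iff[OF L, of f]
    by (auto simp: Hol_def normalizer_def stabilizer_def carrP)
  have lc: "f <#\<^bsub>?P\<^esub> ?L = (\<lambda>x. compose (carrier N) f (left_regular N x)) ` carrier N"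
    and rc: "?L #>\<^bsub>?P\<^esub> f = (\<lambda>x. compose (carrier N) (left_regular N x) f) ` carrier N"
    if "f \<in> Bij (carrier N)" for f
    using that left_regular_in_Bij[OF assms]
    by (auto simp: l_coset_def r_coset_def BijGroup_def)
  show ?thesis
  proof (intro Set.set_eqI iffI)
    fix f assume "f \<in> carrier (Hol N)"
    then have f: "f \<in> Bij (carrier N)" and eq: "f <#\<^bsub>?P\<^esub> ?L = ?L #>\<^bsub>?P\<^esub> f"
      using mem by auto
    have fc: "f x \<in> carrier N" if "x \<in> carrier N" for x
      using f that by (auto simp: Bij_def bij_betw_def)
    have "f (x \<otimes>\<^bsub>N\<^esub> y) = f x \<otimes>\<^bsub>N\<^esub> inv\<^bsub>N\<^esub> (f \<one>\<^bsub>N\<^esub>) \<otimes>\<^bsub>N\<^esub> f y"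
      if x: "x \<in> carrier N" and y: "y \<in> carrier N" for x y
    proof -
      have "compose (carrier N) f (left_regular N x) \<in> ?L #>\<^bsub>?P\<^esub> f"
        using x lc[OF f] eq by blast
      then obtain z where z: "z \<in> carrier N"
        and e: "compose (carrier N) f (left_regular N x) = compose (carrier N) (left_regular N z) f"
        using rc[OF f] by blast
      have e: "f (x \<otimes>\<^bsub>N\<^esub> u) = z \<otimes>\<^bsub>N\<^esub> f u" if u: "u \<in> carrier N" for u
        using fun_cong[OF e, of u] u x z fc by (simp add: compose_def left_regular_def)
      have "f x = z \<otimes>\<^bsub>N\<^esub> f \<one>\<^bsub>N\<^esub>"
        using e[of "\<one>\<^bsub>N\<^esub>"] x by simp
      then have "z = f x \<otimes>\<^bsub>N\<^esub> inv\<^bsub>N\<^esub> (f \<one>\<^bsub>N\<^esub>)"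
        using z x fc by (simp add: N.inv_solve_right)
      with e[OF y] show ?thesis by simp
    qed
    with f show "f \<in> ?A" by blast
  next
    fix f assume "f \<in> ?A"
    then have f: "f \<in> Bij (carrier N)"
      and aff: "\<And>x y. x \<in> carrier N \<Longrightarrow> y \<in> carrier N \<Longrightarrow>
        f (x \<otimes>\<^bsub>N\<^esub> y) = f x \<otimes>\<^bsub>N\<^esub> inv\<^bsub>N\<^esub> (f \<one>\<^bsub>N\<^esub>) \<otimes>\<^bsub>N\<^esub> f y" by auto
    have img: "f ` carrier N = carrier N"
      using f by (auto simp: Bij_def bij_betw_def)
    then have fc: "f x \<in> carrier N" if "x \<in> carrier N" for x
      using that by auto
    let ?s = "\<lambda>x. f x \<otimes>\<^bsub>N\<^esub> inv\<^bsub>N\<^esub> (f \<one>\<^bsub>N\<^esub>)"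
    have step: "compose (carrier N) f (left_regular N x) = compose (carrier N) (left_regular N (?s x)) f"
      if "x \<in> carrier N" for x
      using that fc aff by (auto simp: compose_def left_regular_def fun_eq_iff)
    have s: "?s ` carrier N = carrier N"
    proof (intro equalityI subsetI)
      fix z assume z: "z \<in> carrier N"
      then have "z \<otimes>\<^bsub>N\<^esub> f \<one>\<^bsub>N\<^esub> \<in> f ` carrier N"
        using img fc by simp
      then obtain x where "x \<in> carrier N" "f x = z \<otimes>\<^bsub>N\<^esub> f \<one>\<^bsub>N\<^esub>" by auto
      then show "z \<in> ?s ` carrier N"
        using z fc by (intro image_eqI[of _ _ x]) (auto simp: N.m_assoc)
    qed (use fc in auto)
    have "f <#\<^bsub>?P\<^esub> ?L = (\<lambda>x. compose (carrier N) (left_regular N (?s x)) f) ` carrier N"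
      using lc[OF f] step by simp
    also have "\<dots> = (\<lambda>x. compose (carrier N) (left_regular N x) f) ` (?s ` carrier N)"
      by (simp add: image_image)
    also have "\<dots> = ?L #>\<^bsub>?P\<^esub> f"
      by (simp only: s rc[OF f])
    finally show "f \<in> carrier (Hol N)"
      using mem f by blast
  qed
qed

lemma mult_Hol:
  assumes "f \<in> Bij (carrier N)" "g \<in> Bij (carrier N)"
  shows "f \<otimes>\<^bsub>Hol N\<^esub> g = compose (carrier N) f g"
  using assms by (simp add: Hol_def BijGroup_def)

lemma stabilizer_Hol:
  "stabilizer ((Hol N)\<lparr>carrier := S\<rparr>) id x = {f \<in> S. f x = x}"
  by (simp add: stabilizer_def)

text \<open>The easy half of \<open>Hol N = N \<rtimes> Aut N\<close>; only \<open>f\<close> itself is asked to be bijective, which then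
  forces \<open>\<theta>\<close> to be an automorphism.\<close>
lemma translate_hom_in_Hol:
  assumes "group N" "f \<in> Bij (carrier N)" "a \<in> carrier N" "\<theta> \<in> hom N N"
    and "\<And>y. y \<in> carrier N \<Longrightarrow> f y = a \<otimes>\<^bsub>N\<^esub> \<theta> y"
  shows "f \<in> carrier (Hol N)"
proof -
  interpret N: group N by fact
  have c: "\<theta> y \<in> carrier N" if "y \<in> carrier N" for y
    using assms(4) that by (rule hom_in_carrier)
  have m: "\<theta> (y \<otimes>\<^bsub>N\<^esub> z) = \<theta> y \<otimes>\<^bsub>N\<^esub> \<theta> z" if "y \<in> carrier N" "z \<in> carrier N" for y z
    using assms(4) that by (rule hom_mult)
  have "\<theta> \<one>\<^bsub>N\<^esub> = \<one>\<^bsub>N\<^esub>"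
    using assms(4) by (simp add: hom_one N.group_axioms)
  then show ?thesis
    using assms(2,3,5) c m
    by (auto simp: carrier_Hol[OF assms(1)] N.m_assoc N.inv_solve_left)
qed

text \<open>Two group structures on one set have their holomorphs in the same symmetric group, so that an
  embedding into the smaller holomorph serves for the larger one. Sharing the identity element keeps
  the stabilizer unchanged.\<close>
lemma realizable_mono:
  assumes "realizable G H N" "group B" "carrier B = carrier N" "\<one>\<^bsub>B\<^esub> = \<one>\<^bsub>N\<^esub>"
    and sub: "carrier (Hol N) \<subseteq> carrier (Hol B)"
  shows "realizable G H B"
proof -
  have "monoid.mult (Hol N) = monoid.mult (Hol B)"
    by (simp add: Hol_def assms(3))
  then have "mon G (Hol N) \<subseteq> mon G (Hol B)"
    using sub by (auto simp: mon_def hom_def)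
  moreover have "order B = order N"
    by (simp add: order_def assms(3))
  ultimately show ?thesis
    using assms(1,2,4) by (auto simp: realizable_def stabilizer_Hol)
qed

text \<open>Conjugation with an isomorphism \<open>\<phi>\<close> from \<open>N\<close> to \<open>A\<close> carries \<open>Hol N\<close> to \<open>Hol A\<close>; since \<open>\<phi>\<close>
  preserves the identity, it carries point stabilizers to point stabilizers.\<close>
lemma realizable_iso:
  assumes real: "realizable G H N" and "group A" and "N \<cong> A"
  shows "realizable G H A"
proof -
  from real obtain \<beta> where \<beta>: "\<beta> \<in> mon G (Hol N)"
    and stab: "\<beta> ` H = {f \<in> \<beta> ` carrier G. f \<one>\<^bsub>N\<^esub> = \<one>\<^bsub>N\<^esub>}"
    and N: "group N" and oN: "order N = card (rcosets\<^bsub>G\<^esub> H)"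
    by (auto simp: realizable_def stabilizer_Hol)
  interpret N: group N by fact
  interpret A: group A by fact
  obtain \<phi> where "\<phi> \<in> Group.iso N A"
    using \<open>N \<cong> A\<close> by (auto simp: is_iso_def)
  then obtain \<psi> where "group_isomorphisms N A \<phi> \<psi>"
    using N.iso_iff_group_isomorphisms by blast
  then have \<phi>: "\<phi> \<in> hom N A" and \<psi>: "\<psi> \<in> hom A N"
    and \<psi>\<phi>: "\<And>x. x \<in> carrier N \<Longrightarrow> \<psi> (\<phi> x) = x"
    and \<phi>\<psi>: "\<And>y. y \<in> carrier A \<Longrightarrow> \<phi> (\<psi> y) = y"
    by (auto simp: group_isomorphisms_def)
  interpret \<phi>: group_hom N A \<phi> by unfold_locales fact
  interpret \<psi>: group_hom A N \<psi> by unfold_locales fact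
  have bij\<phi>: "bij_betw \<phi> (carrier N) (carrier A)" and bij\<psi>: "bij_betw \<psi> (carrier A) (carrier N)"
    by (auto intro!: bij_betw_byWitness[where f' = \<psi>] bij_betw_byWitness[where f' = \<phi>] simp: \<psi>\<phi> \<phi>\<psi>)
  \<comment> \<open>Elements of a holomorph are undefined outside the carrier, hence the restriction.\<close>
  define T where "T f = (\<lambda>y\<in>carrier A. \<phi> (f (\<psi> y)))" for f
  have T_Bij: "T f \<in> Bij (carrier A)" if f: "f \<in> Bij (carrier N)" for f
  proof -
    have "bij_betw f (carrier N) (carrier N)"
      using f by (auto simp: Bij_def)
    then have "bij_betw (\<phi> \<circ> (f \<circ> \<psi>)) (carrier A) (carrier A)"
      using bij\<phi> bij\<psi> by (blast intro: bij_betw_trans)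
    then show ?thesis
      by (simp add: T_def Bij_def comp_def cong: bij_betw_cong)
  qed
  have closed: "f x \<in> carrier N" if "f \<in> Bij (carrier N)" "x \<in> carrier N" for f x
    using that by (auto simp: Bij_def bij_betw_def)
  have T_Hol: "T f \<in> carrier (Hol A)" if f: "f \<in> carrier (Hol N)" for f
  proof -
    have "f \<in> Bij (carrier N)" using f carrier_Hol[OF N] by blast
    then show ?thesis
      using T_Bij closed f
      by (auto simp: carrier_Hol[OF N] carrier_Hol[OF \<open>group A\<close>] T_def)
  qed
  have T_inj: "f = g"
    if "f \<in> Bij (carrier N)" "g \<in> Bij (carrier N)" and eq: "T f = T g" for f g
  proof (rule extensionalityI[of _ "carrier N"])
    show "f \<in> extensional (carrier N)" "g \<in> extensional (carrier N)"
      using that by (auto simp: Bij_def)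
    fix x assume x: "x \<in> carrier N"
    then have "\<phi> (f x) = \<phi> (g x)"
      using fun_cong[OF eq, of "\<phi> x"] by (simp add: T_def \<psi>\<phi>)
    then show "f x = g x"
      using x that closed by (metis \<psi>\<phi>)
  qed
  have \<beta>B: "\<beta> g \<in> Bij (carrier N)" if "g \<in> carrier G" for g
    using \<beta> that carrier_Hol[OF N] by (auto simp: mon_def hom_def)
  have "T \<circ> \<beta> \<in> mon G (Hol A)"
    unfolding mon_def
  proof (intro CollectI conjI homI)
    show "(T \<circ> \<beta>) g \<in> carrier (Hol A)" if "g \<in> carrier G" for g
      using \<beta> that T_Hol by (auto simp: mon_def hom_def)
    show "(T \<circ> \<beta>) (g \<otimes>\<^bsub>G\<^esub> h) = (T \<circ> \<beta>) g \<otimes>\<^bsub>Hol A\<^esub> (T \<circ> \<beta>) h"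
      if "g \<in> carrier G" "h \<in> carrier G" for g h
    proof -
      have "\<beta> (g \<otimes>\<^bsub>G\<^esub> h) = compose (carrier N) (\<beta> g) (\<beta> h)"
        using \<beta> that \<beta>B mult_Hol[of "\<beta> g" N "\<beta> h"] by (auto simp: mon_def hom_def)
      then show ?thesis
        using that \<beta>B T_Bij closed
        by (auto simp: mult_Hol T_def compose_def fun_eq_iff \<psi>\<phi>)
    qed
    show "inj_on (T \<circ> \<beta>) (carrier G)"
      using \<beta> \<beta>B T_inj by (auto simp: mon_def inj_on_def)
  qed
  moreover have "(T \<circ> \<beta>) ` H = {f \<in> (T \<circ> \<beta>) ` carrier G. f \<one>\<^bsub>A\<^esub> = \<one>\<^bsub>A\<^esub>}"
  proof -
    have fix_iff: "T (\<beta> g) \<one>\<^bsub>A\<^esub> = \<one>\<^bsub>A\<^esub> \<longleftrightarrow> \<beta> g \<one>\<^bsub>N\<^esub> = \<one>\<^bsub>N\<^esub>" if "g \<in> carrier G" for g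
      using closed[OF \<beta>B[OF that], of "\<one>\<^bsub>N\<^esub>"] \<psi>\<phi>[of "\<beta> g \<one>\<^bsub>N\<^esub>"]
      by (auto simp: T_def)
    have "(T \<circ> \<beta>) ` H = T ` {f \<in> \<beta> ` carrier G. f \<one>\<^bsub>N\<^esub> = \<one>\<^bsub>N\<^esub>}"
      unfolding stab[symmetric] by (simp add: image_comp)
    also have "\<dots> = {f \<in> (T \<circ> \<beta>) ` carrier G. f \<one>\<^bsub>A\<^esub> = \<one>\<^bsub>A\<^esub>}"
      using fix_iff by auto
    finally show ?thesis .
  qed
  moreover have "order A = card (rcosets\<^bsub>G\<^esub> H)"
    using iso_same_card[OF \<open>N \<cong> A\<close>] oN by (simp add: order_def)
  ultimately show ?thesis
    using real \<open>group A\<close> unfolding realizable_def stabilizer_Hol by blast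
qed


section \<open>Normal subgroups of prime order in a p-group\<close>

lemma (in group) conj_nat_pow:
  assumes "x \<in> carrier G" "c \<in> carrier G"
  shows "x \<otimes> c [^] (m::nat) \<otimes> inv x = (x \<otimes> c \<otimes> inv x) [^] m"
proof (induction m)
  case (Suc m)
  have "x \<otimes> c [^] Suc m \<otimes> inv x = (x \<otimes> c [^] m \<otimes> inv x) \<otimes> (x \<otimes> c \<otimes> inv x)"
    using assms by (simp add: m_assoc inv_solve_left)
  then show ?case by (simp add: Suc.IH)
qed (use assms in simp)

lemma (in group) nat_pow_cong:
  assumes "c \<in> carrier G" "[i = j] (mod ord c)"
  shows "c [^] i = c [^] j"
proof -
  have "int (ord c) dvd int j - int i"
    using assms(2) by (metis cong_iff_dvd_diff cong_int_iff cong_sym)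
  then show ?thesis
    using int_pow_eq[OF assms(1), of "int i" "int j"] by (simp add: int_pow_int)
qed

lemma cong_power_prime_power:
  fixes p k :: nat
  assumes "Factorial_Ring.prime p"
  shows "[k ^ p ^ n = k] (mod p)"
proof (induction n)
  case (Suc n)
  have fermat: "[k ^ p = k] (mod p)" for k :: nat
  proof (cases "p dvd k")
    case True
    then have "p dvd k ^ p"
      using prime_gt_0_nat[OF assms] by (simp add: dvd_power_iff_le dvd_trans[OF True] dvd_power)
    with True show ?thesis by (simp add: cong_def dvd_eq_mod_eq_0)
  next
    case False
    have "[k * k ^ (p - 1) = k * 1] (mod p)"
      using fermat_theorem[OF assms False] by (rule cong_scalar_left)
    then show ?thesis
      using prime_gt_0_nat[OF assms] by (simp flip: power_Suc)
  qed
  have "[(k ^ p ^ n) ^ p = k ^ p ^ n] (mod p)" by (rule fermat)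
  with Suc.IH show ?case
    by (metis cong_trans mult.commute power_Suc power_mult)
qed simp

text \<open>Conjugation by \<open>x\<close> maps a generator \<open>c\<close> of \<open>K\<close> to some power \<open>c^k\<close>, so conjugation by \<open>x^i\<close> maps
  it to \<open>c\<close> to the power \<open>k^i\<close>. For \<open>i = p^n\<close> the conjugation is trivial, while \<open>k^i\<close> is congruent to \<open>k\<close>
  modulo \<open>p\<close> by Fermat; hence \<open>c = c^k\<close>.\<close>
lemma (in group) normal_prime_order_central:
  assumes p: "Factorial_Ring.prime p" and G: "order G = p ^ n"
    and K: "K \<lhd> G" "card K = p" and c: "c \<in> K" and x: "x \<in> carrier G"
  shows "c \<otimes> x = x \<otimes> c"
proof (cases "c = \<one>")
  case False
  interpret K: normal K G by fact
  have cG: "c \<in> carrier G" using c by (rule K.mem_carrier)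
  have sub: "c [^] i \<in> K" for i :: nat
    using subgroup_int_pow_closed[OF K.subgroup_axioms c, of "int i"] by (simp add: int_pow_int)
  have "c [^] p = \<one>"
    using group.pow_order_eq_1[OF K.subgroup_is_group[OF group_axioms], of c] c K(2)
    by (simp add: order_def flip: nat_pow_consistent)
  then have ord: "ord c = p"
    using False p cG by (metis ord_eq_1 pow_eq_id prime_nat_iff)
  have "inj_on (\<lambda>i. c [^] i) {0..p - 1}"
    using ord_inj[OF cG] ord by simp
  then have "card ((\<lambda>i. c [^] i) ` {0..p - 1}) = card K"
    using prime_gt_0_nat[OF p] K(2) by (simp add: card_image)
  moreover have "finite K"
    using prime_gt_0_nat[OF p] K(2) by (simp add: card_ge_0_finite)
  ultimately have gen: "(\<lambda>i. c [^] i) ` {0..p - 1} = K"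
    using sub by (intro card_subset_eq) auto
  have "x \<otimes> c \<otimes> inv x \<in> K"
    using K.inv_op_closed2 x c by blast
  then obtain k :: nat where k: "x \<otimes> c \<otimes> inv x = c [^] k"
    unfolding gen[symmetric] by auto
  have iter: "x [^] i \<otimes> c \<otimes> inv (x [^] i) = c [^] (k ^ i)" for i :: nat
  proof (induction i)
    case (Suc i)
    have "x [^] Suc i \<otimes> c \<otimes> inv (x [^] Suc i) = x \<otimes> (x [^] i \<otimes> c \<otimes> inv (x [^] i)) \<otimes> inv x"
      using x cG by (subst (1 2) nat_pow_Suc2) (simp_all add: m_assoc inv_mult_group)
    also have "\<dots> = (c [^] k) [^] (k ^ i)"
      using x cG by (simp add: Suc.IH conj_nat_pow k)
    finally show ?case
      using cG by (simp add: nat_pow_pow)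
  qed (use cG in simp)
  have "c = c [^] (k ^ p ^ n)"
    using iter[of "p ^ n"] pow_order_eq_1[OF x] G cG by simp
  also have "\<dots> = c [^] k"
    using nat_pow_cong[OF cG] cong_power_prime_power[OF p] ord by blast
  finally show ?thesis
    using k x cG by (metis inv_solve_right m_closed)
qed (use x in simp)

section \<open>The abelian group of Baer\<close>

definition commutator :: "('a, 'b) monoid_scheme \<Rightarrow> 'a \<Rightarrow> 'a \<Rightarrow> 'a" where
  "commutator G x y = x \<otimes>\<^bsub>G\<^esub> y \<otimes>\<^bsub>G\<^esub> inv\<^bsub>G\<^esub> x \<otimes>\<^bsub>G\<^esub> inv\<^bsub>G\<^esub> y"

definition center :: "('a, 'b) monoid_scheme \<Rightarrow> 'a set" where
  "center G = {c \<in> carrier G. \<forall>x\<in>carrier G. c \<otimes>\<^bsub>G\<^esub> x = x \<otimes>\<^bsub>G\<^esub> c}"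

context group
begin

lemma center_closed: "c \<in> center G \<Longrightarrow> c \<in> carrier G"
  by (simp add: center_def)

lemma center_comm: "c \<in> center G \<Longrightarrow> x \<in> carrier G \<Longrightarrow> c \<otimes> x = x \<otimes> c"
  by (simp add: center_def)

lemma center_lcomm:
  "c \<in> center G \<Longrightarrow> x \<in> carrier G \<Longrightarrow> y \<in> carrier G \<Longrightarrow> c \<otimes> (x \<otimes> y) = x \<otimes> (c \<otimes> y)"
  by (metis center_closed center_comm m_assoc)

lemma subgroup_center: "subgroup (center G) G"
proof (rule subgroupI)
  show "center G \<subseteq> carrier G" by (auto simp: center_def)
  have "\<one> \<in> center G" by (simp add: center_def)
  then show "center G \<noteq> {}" by blast
next
  fix c assume c: "c \<in> center G"
  have "inv c \<otimes> x = x \<otimes> inv c" if "x \<in> carrier G" for x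
  proof -
    have "inv (c \<otimes> inv x) = inv (inv x \<otimes> c)"
      using center_comm[OF c, of "inv x"] that by simp
    then show ?thesis
      using that center_closed[OF c] by (simp add: inv_mult_group)
  qed
  then show "inv c \<in> center G"
    using center_closed[OF c] by (simp add: center_def)
next
  fix c d assume c: "c \<in> center G" and d: "d \<in> center G"
  have "c \<otimes> d \<otimes> x = x \<otimes> (c \<otimes> d)" if x: "x \<in> carrier G" for x
  proof -
    have "c \<otimes> d \<otimes> x = c \<otimes> (x \<otimes> d)"
      using x c d center_closed by (simp add: m_assoc center_comm[OF d])
    also have "\<dots> = x \<otimes> (c \<otimes> d)"
      using x c d center_closed by (simp add: center_lcomm[OF c])
    finally show ?thesis .
  qed
  moreover have "c \<otimes> d \<in> carrier G"
    using c d center_closed by simp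
  ultimately show "c \<otimes> d \<in> center G"
    unfolding center_def by blast
qed

lemma center_nat_pow: "c \<in> center G \<Longrightarrow> c [^] (n::nat) \<in> center G"
  using subgroup_int_pow_closed[OF subgroup_center, of c "int n"] by (simp add: int_pow_int)

lemma inv_cancel_left:
  "x \<in> carrier G \<Longrightarrow> y \<in> carrier G \<Longrightarrow> inv x \<otimes> (x \<otimes> y) = y"
  "x \<in> carrier G \<Longrightarrow> y \<in> carrier G \<Longrightarrow> x \<otimes> (inv x \<otimes> y) = y"
  by (simp_all flip: m_assoc)

lemma commutator_closed [simp, intro]:
  "x \<in> carrier G \<Longrightarrow> y \<in> carrier G \<Longrightarrow> commutator G x y \<in> carrier G"
  by (simp add: commutator_def)

lemma commutator_swap:
  "x \<in> carrier G \<Longrightarrow> y \<in> carrier G \<Longrightarrow> inv (commutator G x y) = commutator G y x"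
  by (simp add: commutator_def inv_mult_group m_assoc)

lemma mult_commutator:
  "x \<in> carrier G \<Longrightarrow> y \<in> carrier G \<Longrightarrow> x \<otimes> y = commutator G x y \<otimes> (y \<otimes> x)"
  by (simp add: commutator_def m_assoc inv_cancel_left)

lemma commutator_eq_one:
  assumes "x \<in> carrier G" "y \<in> carrier G" "x \<otimes> y = y \<otimes> x"
  shows "commutator G x y = \<one>"
proof -
  have "commutator G x y = y \<otimes> x \<otimes> inv x \<otimes> inv y"
    unfolding commutator_def assms(3) ..
  also have "\<dots> = \<one>"
    using assms(1,2) by (simp add: m_assoc)
  finally show ?thesis .
qed

end

lemma hom_commutator:
  assumes "group_hom G H \<phi>" "x \<in> carrier G" "y \<in> carrier G"
  shows "\<phi> (commutator G x y) = commutator H (\<phi> x) (\<phi> y)"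
proof -
  interpret group_hom G H \<phi> by fact
  show ?thesis using assms(2,3) by (simp add: commutator_def)
qed

text \<open>For suitable \<open>h\<close> this is the square root of \<open>[y,x]\<close>. The arguments are swapped because the
  square root is to correct \<open>x y\<close> half of the way towards \<open>y x = [y,x] x y\<close>.\<close>
definition half_commutator :: "('a, 'b) monoid_scheme \<Rightarrow> nat \<Rightarrow> 'a \<Rightarrow> 'a \<Rightarrow> 'a" where
  "half_commutator G h x y = commutator G y x [^]\<^bsub>G\<^esub> h"

definition baer :: "('a, 'b) monoid_scheme \<Rightarrow> nat \<Rightarrow> ('a, 'b) monoid_scheme" where
  "baer G h = G\<lparr>monoid.mult := \<lambda>x y. x \<otimes>\<^bsub>G\<^esub> y \<otimes>\<^bsub>G\<^esub> half_commutator G h x y\<rparr>"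

text \<open>The first axiom says that the nilpotency class is at most two, the second that \<open>h\<close> acts as one
  half on commutators. Central commutators are bimultiplicative, which makes \<open>\<beta>\<close> below an alternating
  bimultiplicative map into the center that is trivial on central elements; any such map twists \<open>G\<close>
  into another group with the same powers, and halving makes this one abelian.\<close>
locale halvable_class_two = group G for G (structure) +
  fixes h :: nat
  assumes commutator_central: "x \<in> carrier G \<Longrightarrow> y \<in> carrier G \<Longrightarrow> commutator G x y \<in> center G"
    and commutator_halve:
      "x \<in> carrier G \<Longrightarrow> y \<in> carrier G \<Longrightarrow> commutator G x y [^] (2 * h) = commutator G x y"
begin

abbreviation \<beta> :: "'a \<Rightarrow> 'a \<Rightarrow> 'a" where
  "\<beta> \<equiv> half_commutator G h"

abbreviation B :: "('a, 'b) monoid_scheme" where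
  "B \<equiv> baer G h"

lemma baer_simps [simp]:
  "carrier B = carrier G" "\<one>\<^bsub>B\<^esub> = \<one>" "x \<otimes>\<^bsub>B\<^esub> y = x \<otimes> y \<otimes> \<beta> x y"
  by (simp_all add: baer_def)

lemma \<beta>_central: "x \<in> carrier G \<Longrightarrow> y \<in> carrier G \<Longrightarrow> \<beta> x y \<in> center G"
  by (simp add: half_commutator_def commutator_central center_nat_pow)

lemma \<beta>_closed [simp, intro]: "x \<in> carrier G \<Longrightarrow> y \<in> carrier G \<Longrightarrow> \<beta> x y \<in> carrier G"
  by (simp add: half_commutator_def)

lemma commutator_mult_left:
  assumes "x \<in> carrier G" "y \<in> carrier G" "z \<in> carrier G"
  shows "commutator G (x \<otimes> y) z = commutator G x z \<otimes> commutator G y z"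
proof -
  have "commutator G (x \<otimes> y) z = x \<otimes> (commutator G y z \<otimes> (z \<otimes> inv x \<otimes> inv z))"
    using assms by (simp add: commutator_def m_assoc inv_mult_group inv_cancel_left)
  also have "\<dots> = commutator G y z \<otimes> (x \<otimes> (z \<otimes> inv x \<otimes> inv z))"
    using assms by (intro center_lcomm[OF commutator_central, symmetric] m_closed inv_closed)
  also have "\<dots> = commutator G y z \<otimes> commutator G x z"
    using assms by (simp add: commutator_def m_assoc)
  also have "\<dots> = commutator G x z \<otimes> commutator G y z"
    using assms by (intro center_comm commutator_central commutator_closed)
  finally show ?thesis .
qed

lemma commutator_mult_right:
  assumes "x \<in> carrier G" "y \<in> carrier G" "z \<in> carrier G"
  shows "commutator G z (x \<otimes> y) = commutator G z x \<otimes> commutator G z y"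
proof -
  have "commutator G z (x \<otimes> y) = inv (commutator G x z \<otimes> commutator G y z)"
    using assms commutator_swap[of "x \<otimes> y" z] by (simp add: commutator_mult_left)
  also have "\<dots> = commutator G z y \<otimes> commutator G z x"
    using assms by (simp add: inv_mult_group commutator_swap)
  also have "\<dots> = commutator G z x \<otimes> commutator G z y"
    using assms by (intro center_comm commutator_central commutator_closed)
  finally show ?thesis .
qed

lemma \<beta>_mult_left:
  assumes "x \<in> carrier G" "y \<in> carrier G" "z \<in> carrier G"
  shows "\<beta> (x \<otimes> y) z = \<beta> x z \<otimes> \<beta> y z"
  using assms by (simp add: half_commutator_def commutator_mult_right pow_mult_distrib[OF center_comm[OF commutator_central]])

lemma \<beta>_mult_right:
  assumes "x \<in> carrier G" "y \<in> carrier G" "z \<in> carrier G"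
  shows "\<beta> z (x \<otimes> y) = \<beta> z x \<otimes> \<beta> z y"
  using assms by (simp add: half_commutator_def commutator_mult_left pow_mult_distrib[OF center_comm[OF commutator_central]])

lemma \<beta>_commuting:
  assumes "x \<in> carrier G" "y \<in> carrier G" "x \<otimes> y = y \<otimes> x"
  shows "\<beta> x y = \<one>"
  using assms by (simp add: half_commutator_def commutator_eq_one)

lemma \<beta>_center:
  assumes "c \<in> center G" "x \<in> carrier G"
  shows "\<beta> c x = \<one>" "\<beta> x c = \<one>"
  using assms \<beta>_commuting[of c x] \<beta>_commuting[of x c] center_closed center_comm[of c x] by simp_all

text \<open>Halving says that \<open>\<beta> x y\<close> squares to \<open>[y,x]\<close>, and \<open>\<beta> y x\<close> is its inverse. This relation is what
  makes the new operation commutative.\<close>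
lemma \<beta>_swap:
  assumes "x \<in> carrier G" "y \<in> carrier G"
  shows "\<beta> x y = commutator G y x \<otimes> \<beta> y x"
proof -
  let ?c = "commutator G y x"
  have "?c [^] h \<otimes> ?c [^] h = ?c"
    using assms commutator_halve by (simp add: nat_pow_mult mult_2)
  then have "?c [^] h = ?c \<otimes> inv (?c [^] h)"
    using assms by (simp add: inv_solve_right)
  also have "inv (?c [^] h) = \<beta> y x"
    using assms by (simp add: half_commutator_def commutator_swap flip: nat_pow_inv)
  finally show ?thesis
    unfolding half_commutator_def[of G h x y] .
qed

lemma comm_group_baer: "comm_group B"
proof (rule comm_groupI; unfold baer_simps)
  fix x y assume x: "x \<in> carrier G" and y: "y \<in> carrier G"
  show "x \<otimes> y \<otimes> \<beta> x y \<in> carrier G" using x y by simp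
  have "x \<otimes> y \<otimes> \<beta> x y = commutator G x y \<otimes> (y \<otimes> x) \<otimes> (commutator G y x \<otimes> \<beta> y x)"
    using x y mult_commutator[of x y] \<beta>_swap[of x y] by simp
  also have "\<dots> = (commutator G x y \<otimes> commutator G y x) \<otimes> (y \<otimes> x \<otimes> \<beta> y x)"
    using x y center_lcomm[OF commutator_central[OF y x]] by (simp add: m_assoc)
  also have "commutator G x y \<otimes> commutator G y x = \<one>"
    using x y by (simp flip: commutator_swap[of x y])
  finally show "x \<otimes> y \<otimes> \<beta> x y = y \<otimes> x \<otimes> \<beta> y x"
    using x y by simp
next
  fix x y z assume xyz: "x \<in> carrier G" "y \<in> carrier G" "z \<in> carrier G"
  have c: "\<beta> u v \<in> center G" "\<beta> u v \<in> carrier G" if "u \<in> {x, y, z}" "v \<in> {x, y, z}" for u v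
    using that xyz \<beta>_central center_closed by blast+
  have "x \<otimes> y \<otimes> \<beta> x y \<otimes> z \<otimes> \<beta> (x \<otimes> y \<otimes> \<beta> x y) z = x \<otimes> y \<otimes> (\<beta> x y \<otimes> (z \<otimes> (\<beta> x z \<otimes> \<beta> y z)))"
    using xyz c by (simp add: \<beta>_mult_left \<beta>_center m_assoc)
  also have "\<dots> = x \<otimes> y \<otimes> (z \<otimes> (\<beta> x y \<otimes> (\<beta> x z \<otimes> \<beta> y z)))"
    using xyz c center_lcomm[of "\<beta> x y" z "\<beta> x z \<otimes> \<beta> y z"] by simp
  also have "\<beta> x y \<otimes> (\<beta> x z \<otimes> \<beta> y z) = \<beta> y z \<otimes> (\<beta> x y \<otimes> \<beta> x z)"
    using c center_comm[of "\<beta> y z" "\<beta> x y \<otimes> \<beta> x z"] by (simp add: m_assoc)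
  also have "x \<otimes> y \<otimes> (z \<otimes> (\<beta> y z \<otimes> (\<beta> x y \<otimes> \<beta> x z))) =
      x \<otimes> (y \<otimes> z \<otimes> \<beta> y z) \<otimes> \<beta> x (y \<otimes> z \<otimes> \<beta> y z)"
    using xyz c by (simp add: \<beta>_mult_right \<beta>_center m_assoc)
  finally show "x \<otimes> y \<otimes> \<beta> x y \<otimes> z \<otimes> \<beta> (x \<otimes> y \<otimes> \<beta> x y) z =
    x \<otimes> (y \<otimes> z \<otimes> \<beta> y z) \<otimes> \<beta> x (y \<otimes> z \<otimes> \<beta> y z)" .
next
  fix x assume x: "x \<in> carrier G"
  show "\<one> \<otimes> x \<otimes> \<beta> \<one> x = x"
    using x by (simp add: \<beta>_commuting)
  have "inv x \<otimes> x \<otimes> \<beta> (inv x) x = \<one>"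
    using x by (simp add: \<beta>_commuting)
  then show "\<exists>y\<in>carrier G. y \<otimes> x \<otimes> \<beta> y x = \<one>"
    using x by blast
qed simp

text \<open>Powers of \<open>x\<close> commute with \<open>x\<close>, so no correction term ever appears.\<close>
lemma nat_pow_baer:
  assumes "x \<in> carrier G"
  shows "x [^]\<^bsub>B\<^esub> (n::nat) = x [^] n"
proof (induction n)
  case (Suc n)
  have "x [^] n \<otimes> x = x \<otimes> x [^] n"
    using assms by (metis nat_pow_Suc nat_pow_Suc2)
  then show ?case
    using assms Suc by (simp add: \<beta>_commuting)
qed simp

lemma ord_baer:
  assumes "x \<in> carrier G"
  shows "group.ord B x = ord x"
proof -
  interpret B: comm_group B by (rule comm_group_baer)
  show ?thesis
    using assms by (simp add: B.ord_def ord_def nat_pow_baer)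
qed

end


section \<open>The holomorph of a group lies in the holomorph of its Baer group\<close>

context halvable_class_two
begin

text \<open>An element of \<open>Hol G\<close> is \<open>y \<mapsto> a \<otimes> \<phi> y\<close> with \<open>\<phi>\<close> an automorphism of \<open>G\<close>. Being
  definable from the operation of \<open>G\<close>, the operation of \<open>B\<close> is preserved by \<open>\<phi>\<close>. The shear \<open>\<psi>\<close>
  absorbs the difference between the two left translations by \<open>a\<close>: it turns the map into
  \<open>y \<mapsto> a \<otimes>\<^bsub>B\<^esub> \<psi> (\<phi> y)\<close>, and it is a homomorphism of \<open>B\<close> since \<open>\<beta> a\<close> is
  multiplicative and kills central elements.\<close>
lemma Hol_subset_Hol_baer: "carrier (Hol G) \<subseteq> carrier (Hol B)"
proof
  interpret B: comm_group B by (rule comm_group_baer)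
  fix f assume "f \<in> carrier (Hol G)"
  then have f: "f \<in> Bij (carrier G)"
    and aff: "\<And>x y. x \<in> carrier G \<Longrightarrow> y \<in> carrier G \<Longrightarrow> f (x \<otimes> y) = f x \<otimes> inv (f \<one>) \<otimes> f y"
    by (auto simp: carrier_Hol[OF group_axioms])
  define a where "a = f \<one>"
  define \<phi> where "\<phi> y = inv a \<otimes> f y" for y
  have fc: "f x \<in> carrier G" if "x \<in> carrier G" for x
    using f that by (auto simp: Bij_def bij_betw_def)
  then have a: "a \<in> carrier G" by (simp add: a_def)
  have \<phi>c: "\<phi> x \<in> carrier G" if "x \<in> carrier G" for x
    using that a fc by (simp add: \<phi>_def)
  have \<phi>_mult: "\<phi> (x \<otimes> y) = \<phi> x \<otimes> \<phi> y" if "x \<in> carrier G" "y \<in> carrier G" for x y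
    using that a fc by (simp add: \<phi>_def aff m_assoc flip: a_def)
  interpret \<phi>: group_hom G G \<phi>
    by unfold_locales (use \<phi>c \<phi>_mult in \<open>simp add: hom_def\<close>)
  have \<phi>_\<beta>: "\<phi> (\<beta> x y) = \<beta> (\<phi> x) (\<phi> y)" if "x \<in> carrier G" "y \<in> carrier G" for x y
    using that hom_commutator[OF \<phi>.group_hom_axioms]
    by (simp add: half_commutator_def \<phi>.hom_nat_pow)
  define \<psi> where "\<psi> y = y \<otimes> inv (\<beta> a y)" for y
  have \<beta>_inv: "inv (\<beta> a y) \<in> center G" if "y \<in> carrier G" for y
    using \<beta>_central[OF a that] subgroup.m_inv_closed[OF subgroup_center] by blast
  have \<psi>_mult: "\<psi> (x \<otimes>\<^bsub>B\<^esub> y) = \<psi> x \<otimes>\<^bsub>B\<^esub> \<psi> y" if x: "x \<in> carrier G" and y: "y \<in> carrier G" for x y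
  proof -
    let ?u = "inv (\<beta> a x)" and ?v = "inv (\<beta> a y)"
    have c: "?u \<in> center G" "?v \<in> center G" "\<beta> x y \<in> center G"
      using \<beta>_inv \<beta>_central x y by blast+
    have cc: "?u \<in> carrier G" "?v \<in> carrier G" "\<beta> x y \<in> carrier G"
      using c center_closed by blast+
    have "\<psi> (x \<otimes>\<^bsub>B\<^esub> y) = x \<otimes> y \<otimes> \<beta> x y \<otimes> (?v \<otimes> ?u)"
      using x y a c by (simp add: \<psi>_def \<beta>_mult_right \<beta>_center inv_mult_group)
    also have "\<dots> = x \<otimes> (y \<otimes> (?u \<otimes> (?v \<otimes> \<beta> x y)))"
    proof -
      have "\<beta> x y \<otimes> (?v \<otimes> ?u) = ?u \<otimes> (?v \<otimes> \<beta> x y)"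
        using cc center_comm[OF c(3), of "?v \<otimes> ?u"] center_lcomm[OF c(1), of ?v "\<beta> x y"]
        by (simp add: m_assoc)
      then show ?thesis using x y cc by (simp add: m_assoc)
    qed
    also have "\<dots> = x \<otimes> ?u \<otimes> (y \<otimes> ?v) \<otimes> \<beta> x y"
      using x y cc center_lcomm[OF c(1), of y "?v \<otimes> \<beta> x y"] by (simp add: m_assoc)
    also have "\<dots> = \<psi> x \<otimes>\<^bsub>B\<^esub> \<psi> y"
      using x y c cc by (simp add: \<psi>_def \<beta>_mult_left \<beta>_mult_right \<beta>_center)
    finally show ?thesis .
  qed
  have "\<psi> \<circ> \<phi> \<in> hom B B"
  proof (rule homI)
    fix x y assume "x \<in> carrier B" "y \<in> carrier B"
    then have x: "x \<in> carrier G" and y: "y \<in> carrier G" by simp_all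
    have "\<phi> (x \<otimes>\<^bsub>B\<^esub> y) = \<phi> x \<otimes>\<^bsub>B\<^esub> \<phi> y"
      using x y by (simp add: \<phi>_mult \<phi>_\<beta>)
    then show "(\<psi> \<circ> \<phi>) (x \<otimes>\<^bsub>B\<^esub> y) = (\<psi> \<circ> \<phi>) x \<otimes>\<^bsub>B\<^esub> (\<psi> \<circ> \<phi>) y"
      using \<psi>_mult[OF \<phi>c[OF x] \<phi>c[OF y]] by (simp del: baer_simps)
  qed (use a \<phi>c in \<open>simp add: \<psi>_def\<close>)
  moreover have "f y = a \<otimes>\<^bsub>B\<^esub> (\<psi> \<circ> \<phi>) y" if "y \<in> carrier B" for y
  proof -
    have y: "y \<in> carrier G" using that by simp
    have w: "\<phi> y \<in> carrier G" "inv (\<beta> a (\<phi> y)) \<in> center G" using \<phi>c \<beta>_inv y by blast+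
    have "a \<otimes>\<^bsub>B\<^esub> (\<psi> \<circ> \<phi>) y = a \<otimes> (\<phi> y \<otimes> inv (\<beta> a (\<phi> y))) \<otimes> \<beta> a (\<phi> y)"
      using a w by (simp add: \<psi>_def \<beta>_mult_right \<beta>_center)
    also have "\<dots> = f y"
      using a w fc[OF y] by (simp add: m_assoc) (simp add: \<phi>_def inv_cancel_left)
    finally show ?thesis by simp
  qed
  moreover have "f \<in> Bij (carrier B)" "a \<in> carrier B"
    using f a by simp_all
  ultimately show "f \<in> carrier (Hol B)"
    using translate_hom_in_Hol[OF B.group_axioms] by blast
qed

end

text \<open>Commutators lie in a central subgroup of order \<open>p\<close>, so raising them to the power
  \<open>p + 1\<close> changes nothing.\<close>
lemma halvable_class_two_if_derived_prime:
  assumes N: "group N" "order N = p ^ n"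
    and p: "Factorial_Ring.prime p" and D: "card (derived N (carrier N)) = p"
    and h: "2 * h = p + 1"
  shows "halvable_class_two N h"
proof -
  interpret group N by fact
  let ?D = "derived N (carrier N)"
  have D_sub: "subgroup ?D N" by (rule derived_is_subgroup) simp
  have comm_D: "commutator N x y \<in> ?D" if "x \<in> carrier N" "y \<in> carrier N" for x y
    using that unfolding derived_def commutator_def by (intro generate.incl) auto
  show ?thesis
  proof unfold_locales
    fix x y assume xy: "x \<in> carrier N" "y \<in> carrier N"
    let ?c = "commutator N x y"
    have c: "?c \<in> ?D" using comm_D xy by blast
    show "?c \<in> center N"
      using normal_prime_order_central[OF p N(2) derived_self_is_normal D c] xy
      by (simp add: center_def)
    have "?c [^]\<^bsub>N\<^esub> p = \<one>\<^bsub>N\<^esub>"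
      using group.pow_order_eq_1[OF subgroup.subgroup_is_group[OF D_sub group_axioms], of ?c] c D
      by (simp add: order_def flip: nat_pow_consistent)
    then show "?c [^]\<^bsub>N\<^esub> (2 * h) = ?c"
      using xy by (simp add: h)
  qed
qed


section \<open>Abelian p-groups are determined by their element orders\<close>

text \<open>In a finite group, counting the solutions of \<open>x^d = 1\<close> is equivalent to counting the elements of
  each order, but unlike the latter it is multiplicative on direct products, so that factors can be cancelled.\<close>
definition torsion_count :: "('a, 'b) monoid_scheme \<Rightarrow> nat \<Rightarrow> nat" where
  "torsion_count G d = card {x \<in> carrier G. x [^]\<^bsub>G\<^esub> d = \<one>\<^bsub>G\<^esub>}"

lemma torsion_count_iso:
  assumes "group G" "group H" "G \<cong> H"
  shows "torsion_count G d = torsion_count H d"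
proof -
  interpret G: group G by fact
  interpret H: group H by fact
  obtain f where f: "f \<in> Group.iso G H"
    using assms(3) by (auto simp: is_iso_def)
  then have hom: "f \<in> hom G H" and img: "f ` carrier G = carrier H" and inj: "inj_on f (carrier G)"
    by (auto simp: Group.iso_iff)
  interpret group_hom G H f by unfold_locales fact
  have iff: "f x [^]\<^bsub>H\<^esub> d = \<one>\<^bsub>H\<^esub> \<longleftrightarrow> x [^]\<^bsub>G\<^esub> d = \<one>\<^bsub>G\<^esub>" if x: "x \<in> carrier G" for x
  proof -
    have "f x [^]\<^bsub>H\<^esub> d = \<one>\<^bsub>H\<^esub> \<longleftrightarrow> f (x [^]\<^bsub>G\<^esub> d) = f \<one>\<^bsub>G\<^esub>"
      using x by (simp add: hom_nat_pow)
    also have "\<dots> \<longleftrightarrow> x [^]\<^bsub>G\<^esub> d = \<one>\<^bsub>G\<^esub>"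
      using x inj by (auto simp: inj_on_def)
    finally show ?thesis .
  qed
  have "f ` {x \<in> carrier G. x [^]\<^bsub>G\<^esub> d = \<one>\<^bsub>G\<^esub>} = {y \<in> carrier H. y [^]\<^bsub>H\<^esub> d = \<one>\<^bsub>H\<^esub>}"
    unfolding img[symmetric] using iff by auto
  moreover have "card (f ` {x \<in> carrier G. x [^]\<^bsub>G\<^esub> d = \<one>\<^bsub>G\<^esub>}) = torsion_count G d"
    unfolding torsion_count_def by (intro card_image inj_on_subset[OF inj]) auto
  ultimately show ?thesis
    by (simp add: torsion_count_def)
qed

lemma nat_pow_DirProd:
  "(x, y) [^]\<^bsub>G \<times>\<times> H\<^esub> (n::nat) = (x [^]\<^bsub>G\<^esub> n, y [^]\<^bsub>H\<^esub> n)"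
  by (induction n) auto

lemma torsion_count_DirProd:
  "torsion_count (G \<times>\<times> H) d = torsion_count G d * torsion_count H d"
proof -
  have "{z \<in> carrier (G \<times>\<times> H). z [^]\<^bsub>G \<times>\<times> H\<^esub> d = \<one>\<^bsub>G \<times>\<times> H\<^esub>} =
      {x \<in> carrier G. x [^]\<^bsub>G\<^esub> d = \<one>\<^bsub>G\<^esub>} \<times> {y \<in> carrier H. y [^]\<^bsub>H\<^esub> d = \<one>\<^bsub>H\<^esub>}"
    by (auto simp: nat_pow_DirProd)
  then show ?thesis
    by (simp add: torsion_count_def card_cartesian_product)
qed

context comm_group
begin

lemma comm_group_subgroup:
  assumes "subgroup H G"
  shows "comm_group (G\<lparr>carrier := H\<rparr>)"
  using subgroup.subset[OF assms]
  by (intro group.group_comm_groupI subgroup_imp_group[OF assms]) (auto intro!: m_comm)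

text \<open>A subgroup \<open>B\<close> that is maximal among those meeting \<open>C = \<langle>a\<rangle>\<close> trivially is a complement. Otherwise
  some \<open>y\<close> outside \<open>M = C B\<close> has its \<open>p\<close>-th power in \<open>M\<close>, say equal to \<open>a^i b\<close>. As the order of \<open>a\<close>
  kills \<open>y\<close>, the exponent \<open>i\<close> is divisible by \<open>p\<close>, and correcting \<open>y\<close> by a power of \<open>a\<close> gives \<open>z\<close>
  outside \<open>M\<close> whose \<open>p\<close>-th power lies in \<open>B\<close>. By maximality \<open>B\<langle>z\<rangle>\<close> contains an element
  \<open>u = b' z^r\<close> of \<open>C\<close> other than the identity. If \<open>p\<close> divides \<open>r\<close>, then \<open>u\<close> lies in \<open>B\<close>; if not, then
  \<open>z\<close> is a product of powers of \<open>z^r\<close> and \<open>z^p\<close>, both in \<open>M\<close>. Both are impossible.\<close>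
lemma cyclic_complement:
  assumes fin: "finite (carrier G)" and p: "Factorial_Ring.prime p"
    and a: "a \<in> carrier G" "ord a = p ^ k"
    and exp: "\<And>x. x \<in> carrier G \<Longrightarrow> ord x dvd ord a"
  obtains B where "subgroup B G" "\<And>i::int. a [^] i \<in> B \<Longrightarrow> a [^] i = \<one>"
    "\<And>x. x \<in> carrier G \<Longrightarrow> \<exists>i::int. \<exists>b\<in>B. x = a [^] i \<otimes> b"
proof -
  define C where "C = range (\<lambda>i::int. a [^] i)"
  have C_gen: "C = generate G {a}"
    using generate_pow[OF a(1)] by (auto simp: C_def)
  have C: "subgroup C G"
    unfolding C_gen using a by (intro generate_is_subgroup) auto
  have aC: "a [^] i \<in> C" for i :: int by (auto simp: C_def)
  define \<B> where "\<B> = {B. subgroup B G \<and> B \<inter> C \<subseteq> {\<one>}}"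
  have "\<B> \<subseteq> Pow (carrier G)"
    by (auto simp: \<B>_def dest: subgroup.subset)
  then have "finite \<B>"
    using fin by (simp add: finite_subset)
  moreover have "{\<one>} \<in> \<B>"
    by (auto simp: \<B>_def triv_subgroup)
  ultimately obtain B where B\<B>: "B \<in> \<B>" and max: "\<And>B'. B' \<in> \<B> \<Longrightarrow> B \<subseteq> B' \<Longrightarrow> B = B'"
    using finite_has_maximal2[of \<B> "{\<one>}"] by blast
  have B: "subgroup B G" and BC: "\<And>x. x \<in> B \<Longrightarrow> x \<in> C \<Longrightarrow> x = \<one>"
    using B\<B> by (auto simp: \<B>_def)
  interpret B: subgroup B G by (rule B)
  interpret C: subgroup C G by (rule C)
  define M where "M = C <#> B"
  have M: "subgroup M G"
    unfolding M_def by (rule mult_subgroups[OF C B])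
  interpret M: subgroup M G by (rule M)
  have CM: "c \<otimes> b \<in> M" if "c \<in> C" "b \<in> B" for b c
    using that by (auto simp: M_def set_mult_def)
  have CsubM: "c \<in> M" if "c \<in> C" for c
    using CM[OF that B.one_closed] that by simp
  have BsubM: "b \<in> M" if "b \<in> B" for b
    using CM[OF C.one_closed that] that by simp
  have p0: "p > 0" using p prime_gt_0_nat by blast
  have "carrier G \<subseteq> M"
  proof (rule ccontr)
    assume "\<not> carrier G \<subseteq> M"
    then obtain x where x: "x \<in> carrier G" "x \<notin> M" by blast
    have kill: "y [^] (p ^ k) = \<one>" if "y \<in> carrier G" for y
      using exp[OF that] a that by (simp add: pow_eq_id)
    \<comment> \<open>The first power of \<open>x\<close> along the chain \<open>x, x^p, x^(p^2), \<dots>\<close> that falls into \<open>M\<close>.\<close>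
    define j where "j = (LEAST j. x [^] (p ^ j) \<in> M)"
    have jM: "x [^] (p ^ j) \<in> M"
      unfolding j_def by (rule LeastI[of _ k]) (use kill x in simp)
    have "j \<noteq> 0"
      using jM x by (intro notI) simp
    then obtain j' where j': "j = Suc j'" using not0_implies_Suc by blast
    define y where "y = x [^] (p ^ j')"
    have y: "y \<in> carrier G" using x by (simp add: y_def)
    have yM: "y \<notin> M"
      unfolding y_def using not_less_Least[of j' "\<lambda>j. x [^] (p ^ j) \<in> M"] j' by (simp add: j_def)
    have "y [^] p \<in> M"
      using jM x by (simp add: y_def j' nat_pow_pow mult.commute)
    then obtain i :: int and b where b: "b \<in> B" and yp: "y [^] p = a [^] i \<otimes> b"
      by (auto simp: M_def set_mult_def C_def)
    have bG: "b \<in> carrier G" using b by simp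
    have "k \<noteq> 0"
    proof
      assume "k = 0"
      then have "x = \<one>" using kill[OF x(1)] x(1) by simp
      then show False using x(2) M.one_closed by simp
    qed
    then obtain k' where k': "k = Suc k'" using not0_implies_Suc by blast
    have "\<one> = (y [^] p) [^] (p ^ k')"
      using kill[OF y] y by (simp add: nat_pow_pow k')
    also have "\<dots> = (a [^] i \<otimes> b) [^] (int (p ^ k'))"
      by (simp only: yp int_pow_int)
    also have "\<dots> = a [^] (i * int (p ^ k')) \<otimes> b [^] int (p ^ k')"
      using a bG by (simp add: int_pow_distrib int_pow_pow)
    finally have "a [^] (i * int (p ^ k')) = inv (b [^] int (p ^ k'))"
      using a bG by (metis int_pow_closed inv_equality)
    then have "a [^] (i * int (p ^ k')) \<in> B"
      using subgroup_int_pow_closed[OF B b] by simp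
    then have "a [^] (i * int (p ^ k')) = \<one>"
      using BC aC by blast
    then have "int (p ^ k) dvd i * int (p ^ k')"
      using a int_pow_eq_id by simp
    then have "int p dvd i"
      using p0 by (simp add: k')
    then obtain i' where i': "i = int p * i'" by blast
    define z where "z = y \<otimes> a [^] (- i')"
    have z: "z \<in> carrier G" using y a by (simp add: z_def)
    have yz: "y = z \<otimes> a [^] i'"
      using y a by (simp add: z_def m_assoc flip: int_pow_mult)
    have zM: "z \<notin> M"
      using yM CsubM[OF aC] yz by auto
    have "z [^] int p = y [^] int p \<otimes> a [^] (- i)"
      using y a by (simp add: z_def int_pow_distrib int_pow_pow i' mult.commute)
    also have "\<dots> = a [^] i \<otimes> b \<otimes> a [^] (- i)"
      by (simp add: yp int_pow_int)
    also have "\<dots> = b \<otimes> (a [^] i \<otimes> a [^] (- i))"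
      using a bG by (simp add: m_ac)
    also have "\<dots> = b"
      using a bG by (simp flip: int_pow_mult)
    finally have zp: "z [^] int p = b" .
    define D where "D = B <#> generate G {z}"
    have gz: "generate G {z} = {z [^] (r :: int) | r. r \<in> UNIV}"
      by (rule generate_pow[OF z])
    have D: "subgroup D G"
      unfolding D_def using z by (intro mult_subgroups B generate_is_subgroup) auto
    have memD: "b' \<otimes> z [^] (r::int) \<in> D" if "b' \<in> B" for b' r
      using that unfolding D_def gz set_mult_def by auto
    have BD: "B \<subseteq> D"
    proof
      fix b' assume "b' \<in> B"
      then show "b' \<in> D" using memD[of b' 0] by simp
    qed
    have zD: "z \<in> D"
      using memD[OF B.one_closed, of 1] z by simp
    have "z \<notin> B" using zM BsubM by blast
    with BD zD max have "D \<notin> \<B>" by blast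
    then obtain u where "u \<in> D" "u \<in> C" "u \<noteq> \<one>"
      using D by (auto simp: \<B>_def)
    then obtain b' and r :: int where b': "b' \<in> B" and u: "u = b' \<otimes> z [^] r"
      unfolding D_def gz set_mult_def by auto
    show False
    proof (cases "int p dvd r")
      case True
      then obtain r' where "r = int p * r'" by blast
      then have "z [^] r = b [^] r'"
        using z by (simp add: int_pow_pow flip: zp)
      then have "u \<in> B"
        using u b' subgroup_int_pow_closed[OF B b] by simp
      then show False using BC \<open>u \<in> C\<close> \<open>u \<noteq> \<one>\<close> by blast
    next
      case False
      then have "coprime (int p) r"
        using p by (intro prime_imp_coprime) auto
      then obtain s t where st: "s * int p + t * r = 1"
        using bezout_int[of "int p" r] by auto
      have "z [^] r = inv b' \<otimes> u"
        using u b' z by (simp flip: m_assoc)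
      then have zr: "z [^] r \<in> M"
        using BsubM[OF B.m_inv_closed[OF b']] CsubM[OF \<open>u \<in> C\<close>] by simp
      have "z = z [^] (int p * s + r * t)"
        using st z by (simp add: mult.commute)
      also have "\<dots> = (z [^] int p) [^] s \<otimes> (z [^] r) [^] t"
        using z by (simp add: int_pow_mult int_pow_pow)
      also have "\<dots> \<in> M"
        using subgroup_int_pow_closed[OF M] BsubM[OF b] zp zr by simp
      finally show False using zM by blast
    qed
  qed
  show thesis
  proof (rule that[OF B])
    fix i :: int assume "a [^] i \<in> B"
    then show "a [^] i = \<one>" using BC aC by blast
  next
    fix x assume "x \<in> carrier G"
    then have "x \<in> M" using \<open>carrier G \<subseteq> M\<close> by blast
    then show "\<exists>i::int. \<exists>b\<in>B. x = a [^] i \<otimes> b"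
      by (auto simp: M_def set_mult_def C_def)
  qed
qed

lemma iso_cyclic_times_complement:
  assumes a: "a \<in> carrier G" "ord a \<noteq> 0" and B: "subgroup B G"
    and inter: "\<And>i::int. a [^] i \<in> B \<Longrightarrow> a [^] i = \<one>"
    and span: "\<And>x. x \<in> carrier G \<Longrightarrow> \<exists>i::int. \<exists>b\<in>B. x = a [^] i \<otimes> b"
  shows "integer_mod_group (ord a) \<times>\<times> G\<lparr>carrier := B\<rparr> \<cong> G"
proof -
  interpret B: subgroup B G by (rule B)
  let ?Z = "integer_mod_group (ord a)" and ?f = "\<lambda>(i::int, b). a [^] i \<otimes> b"
  have pow_mod: "a [^] (i mod int (ord a)) = a [^] i" for i :: int
    using int_pow_eq[OF a(1)] by (simp add: mod_eq_dvd_iff[symmetric])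
  have "?f \<in> hom (?Z \<times>\<times> G\<lparr>carrier := B\<rparr>) G"
  proof (rule homI)
    fix u v assume "u \<in> carrier (?Z \<times>\<times> G\<lparr>carrier := B\<rparr>)" "v \<in> carrier (?Z \<times>\<times> G\<lparr>carrier := B\<rparr>)"
    then obtain i b j c where uv: "u = (i, b)" "v = (j, c)" and bc: "b \<in> B" "c \<in> B" by auto
    have "a [^] (i + j) \<otimes> (b \<otimes> c) = a [^] i \<otimes> b \<otimes> (a [^] j \<otimes> c)"
      using bc a by (simp add: int_pow_mult m_ac)
    then show "?f (u \<otimes>\<^bsub>?Z \<times>\<times> G\<lparr>carrier := B\<rparr>\<^esub> v) = ?f u \<otimes> ?f v"
      by (simp add: uv pow_mod)
  qed (use a in auto)
  moreover have "?f ` carrier (?Z \<times>\<times> G\<lparr>carrier := B\<rparr>) = carrier G"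
  proof (intro equalityI subsetI)
    fix x assume "x \<in> carrier G"
    then obtain i :: int and b where b: "b \<in> B" and x: "x = a [^] i \<otimes> b" using span by blast
    have "(i mod int (ord a), b) \<in> carrier (?Z \<times>\<times> G\<lparr>carrier := B\<rparr>)"
      using b a by (simp add: carrier_integer_mod_group)
    then show "x \<in> ?f ` carrier (?Z \<times>\<times> G\<lparr>carrier := B\<rparr>)"
      by (rule rev_image_eqI) (simp add: x pow_mod)
  qed (use a in auto)
  moreover have "inj_on ?f (carrier (?Z \<times>\<times> G\<lparr>carrier := B\<rparr>))"
  proof (rule inj_onI)
    fix u v assume "u \<in> carrier (?Z \<times>\<times> G\<lparr>carrier := B\<rparr>)" "v \<in> carrier (?Z \<times>\<times> G\<lparr>carrier := B\<rparr>)"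
      and eq: "?f u = ?f v"
    then obtain i b j c where uv: "u = (i, b)" "v = (j, c)" and bc: "b \<in> B" "c \<in> B"
      and ij: "0 \<le> i" "i < int (ord a)" "0 \<le> j" "j < int (ord a)"
      using a by (auto simp: carrier_integer_mod_group)
    have e: "a [^] i \<otimes> b = a [^] j \<otimes> c" using eq by (simp add: uv)
    have "a [^] i = a [^] j \<otimes> (c \<otimes> inv b)"
      using e bc a by (metis B.mem_carrier int_pow_closed inv_closed inv_solve_right m_assoc m_closed)
    then have "a [^] (i - j) = a [^] j \<otimes> (c \<otimes> inv b) \<otimes> inv (a [^] j)"
      using a by (simp add: int_pow_diff)
    also have "\<dots> = a [^] j \<otimes> inv (a [^] j) \<otimes> (c \<otimes> inv b)"
      using bc a by (simp add: m_ac)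
    also have "\<dots> = c \<otimes> inv b"
      using bc a by simp
    finally have "a [^] (i - j) \<in> B"
      using bc by simp
    then have "a [^] (i - j) = \<one>" by (rule inter)
    then have "int (ord a) dvd i - j"
      using a int_pow_eq_id by blast
    then have "i = j"
      using ij by (metis mod_eq_dvd_iff mod_pos_pos_trivial)
    then show "u = v"
      using e bc a uv by simp
  qed
  ultimately have "?f \<in> Group.iso (?Z \<times>\<times> G\<lparr>carrier := B\<rparr>) G"
    by (simp add: Group.iso_iff)
  then show ?thesis by (rule is_isoI)
qed

text \<open>In a \<open>p\<close>-group the element orders form a chain under divisibility, so an element of maximal
  order realizes the exponent of the group.\<close>
lemma cyclic_direct_factor:
  assumes p: "Factorial_Ring.prime p" and ordG: "order G = p ^ n"
  obtains a B where "a \<in> carrier G" "subgroup B G" "\<And>x. x \<in> carrier G \<Longrightarrow> ord x dvd ord a"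
    "integer_mod_group (ord a) \<times>\<times> G\<lparr>carrier := B\<rparr> \<cong> G"
proof -
  have fin: "finite (carrier G)"
    using ordG p order_gt_0_iff_finite prime_gt_0_nat by simp
  then have "finite (ord ` carrier G)" "ord ` carrier G \<noteq> {}" by auto
  then obtain a where a: "a \<in> carrier G" and max: "\<And>x. x \<in> carrier G \<Longrightarrow> ord x \<le> ord a"
    using Max_in[of "ord ` carrier G"] Max_ge[of "ord ` carrier G"] by fastforce
  have ppow: "\<exists>k. ord x = p ^ k" if "x \<in> carrier G" for x
    using ord_dvd_group_order[OF that] p by (auto simp: ordG divides_primepow_nat)
  have exp: "ord x dvd ord a" if x: "x \<in> carrier G" for x
  proof -
    obtain i j where "ord x = p ^ i" "ord a = p ^ j" using ppow x a by blast
    with max[OF x] prime_gt_1_nat[OF p] show ?thesis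
      by (simp add: le_imp_power_dvd)
  qed
  obtain k where k: "ord a = p ^ k" using ppow a by blast
  obtain B where B: "subgroup B G" "\<And>i::int. a [^] i \<in> B \<Longrightarrow> a [^] i = \<one>"
    "\<And>x. x \<in> carrier G \<Longrightarrow> \<exists>i::int. \<exists>b\<in>B. x = a [^] i \<otimes> b"
    using cyclic_complement[OF fin p a k exp] by blast
  have "ord a \<noteq> 0" using k prime_gt_0_nat[OF p] by simp
  then have "integer_mod_group (ord a) \<times>\<times> G\<lparr>carrier := B\<rparr> \<cong> G"
    using iso_cyclic_times_complement[OF a _ B] by blast
  then show thesis using that a B(1) exp by blast
qed

end

text \<open>The exponent of a finite group can thus be read off from its torsion counts.\<close>
lemma (in group) torsion_count_eq_order_iff:
  assumes "finite (carrier G)"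
  shows "torsion_count G d = order G \<longleftrightarrow> (\<forall>x\<in>carrier G. ord x dvd d)"
proof -
  have "torsion_count G d = order G \<longleftrightarrow> {x \<in> carrier G. x [^] d = \<one>} = carrier G"
    unfolding torsion_count_def order_def
    using card_subset_eq[OF assms, of "{x \<in> carrier G. x [^] d = \<one>}"] by auto
  also have "\<dots> \<longleftrightarrow> (\<forall>x\<in>carrier G. ord x dvd d)"
    using pow_eq_id by blast
  finally show ?thesis .
qed

lemma torsion_count_pos:
  assumes "group G" "finite (carrier G)"
  shows "torsion_count G d > 0"
proof -
  interpret group G by fact
  have "\<one>\<^bsub>G\<^esub> \<in> {x \<in> carrier G. x [^]\<^bsub>G\<^esub> d = \<one>\<^bsub>G\<^esub>}" by simp
  then show ?thesis
    using assms(2) by (auto simp: torsion_count_def card_gt_0_iff)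
qed

text \<open>Both groups have the same exponent, hence isomorphic cyclic direct factors of that order. The
  complements are smaller unless the exponent is one, and their torsion counts agree after
  cancelling those of the common cyclic factor.\<close>
lemma abelian_p_groups_iso:
  fixes A :: "('a, 'y) monoid_scheme" and B :: "('b, 'x) monoid_scheme"
  assumes p: "Factorial_Ring.prime p" and "comm_group A" "comm_group B"
    and "order A = p ^ n" "order B = p ^ n"
    and "\<And>d. torsion_count A d = torsion_count B d"
  shows "A \<cong> B"
  using assms(2-)
proof (induction n arbitrary: A B rule: less_induct)
  case (less n)
  note count = less.prems(5)
  interpret A: comm_group A by fact
  interpret B: comm_group B by fact
  have finA: "finite (carrier A)" and finB: "finite (carrier B)"
    using less.prems p A.order_gt_0_iff_finite B.order_gt_0_iff_finite prime_gt_0_nat by simp_all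
  obtain a A1 where a: "a \<in> carrier A" "subgroup A1 A"
    and expA: "\<And>x. x \<in> carrier A \<Longrightarrow> A.ord x dvd A.ord a"
    and isoA: "integer_mod_group (A.ord a) \<times>\<times> A\<lparr>carrier := A1\<rparr> \<cong> A"
    using A.cyclic_direct_factor[OF p less.prems(3)] by blast
  obtain b B1 where b: "b \<in> carrier B" "subgroup B1 B"
    and expB: "\<And>x. x \<in> carrier B \<Longrightarrow> B.ord x dvd B.ord b"
    and isoB: "integer_mod_group (B.ord b) \<times>\<times> B\<lparr>carrier := B1\<rparr> \<cong> B"
    using B.cyclic_direct_factor[OF p less.prems(4)] by blast
  let ?A1 = "A\<lparr>carrier := A1\<rparr>" and ?B1 = "B\<lparr>carrier := B1\<rparr>"
  have same_exp: "A.ord a = B.ord b"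
  proof (rule dvd_antisym)
    have "torsion_count A (B.ord b) = order A"
      using count B.torsion_count_eq_order_iff[OF finB] expB less.prems by metis
    then show "A.ord a dvd B.ord b"
      using A.torsion_count_eq_order_iff[OF finA] a by blast
    have "torsion_count B (A.ord a) = order B"
      using count A.torsion_count_eq_order_iff[OF finA] expA less.prems by metis
    then show "B.ord b dvd A.ord a"
      using B.torsion_count_eq_order_iff[OF finB] b by blast
  qed
  let ?Z = "integer_mod_group (A.ord a)"
  have cA1: "comm_group ?A1" and cB1: "comm_group ?B1"
    using a(2) b(2) A.comm_group_subgroup B.comm_group_subgroup by blast+
  have gA1: "group ?A1" and gB1: "group ?B1"
    using cA1 cB1 by (simp_all add: comm_group_def)
  show ?case
  proof (cases "A.ord a = 1")
    case True
    have "carrier A = {\<one>\<^bsub>A\<^esub>}" "carrier B = {\<one>\<^bsub>B\<^esub>}"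
      using expA expB True same_exp A.ord_eq_1 B.ord_eq_1 by auto
    then have "(\<lambda>_. \<one>\<^bsub>B\<^esub>) \<in> Group.iso A B"
      by (auto simp: Group.iso_iff hom_def)
    then show ?thesis by (rule is_isoI)
  next
    case False
    have ord0: "A.ord a \<noteq> 0"
      using A.ord_ge_1[OF finA a(1)] by simp
    have cardZ: "card (carrier ?Z) = A.ord a"
      using ord0 by (simp add: carrier_integer_mod_group)
    have prodA: "A.ord a * card A1 = p ^ n"
      using iso_same_card[OF isoA] cardZ less.prems(3) by (simp add: order_def card_cartesian_product)
    have prodB: "A.ord a * card B1 = p ^ n"
      using iso_same_card[OF isoB] cardZ less.prems(4) same_exp
      by (simp add: order_def card_cartesian_product)
    have "card A1 dvd p ^ n"
      using prodA by (metis dvd_triv_right)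
    then obtain m where m: "card A1 = p ^ m" "m \<le> n"
      using p by (auto simp: divides_primepow_nat)
    have "m \<noteq> n"
      using prodA m False prime_gt_0_nat[OF p] by auto
    with m have "m < n" by simp
    moreover have "card B1 = p ^ m"
      using prodA prodB ord0 m by (metis mult_cancel1)
    moreover have "torsion_count ?A1 d = torsion_count ?B1 d" for d
    proof -
      have "torsion_count ?Z d * torsion_count ?A1 d = torsion_count A d"
        using torsion_count_iso[OF DirProd_group A.group_axioms isoA] gA1
        by (simp add: torsion_count_DirProd)
      also have "\<dots> = torsion_count ?Z d * torsion_count ?B1 d"
        using torsion_count_iso[OF DirProd_group B.group_axioms isoB] gB1 count same_exp
        by (simp add: torsion_count_DirProd)
      finally show ?thesis
        using torsion_count_pos[of ?Z d] ord0 by (simp add: carrier_integer_mod_group)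
    qed
    ultimately have "?A1 \<cong> ?B1"
      using less.IH[OF _ cA1 cB1] m by (simp add: order_def)
    then obtain g where g: "g \<in> Group.iso ?A1 ?B1" by (auto simp: is_iso_def)
    have "(\<lambda>(x, y). (x, g y)) \<in> Group.iso (?Z \<times>\<times> ?A1) (?Z \<times>\<times> ?B1)"
      using iso_paired2[of ?Z ?A1 "\<lambda>x. x" g ?Z ?B1] g gA1 iso_set_refl by simp
    then have "?Z \<times>\<times> ?A1 \<cong> ?Z \<times>\<times> ?B1" by (rule is_isoI)
    moreover have "A \<cong> ?Z \<times>\<times> ?A1"
      using group.iso_sym[OF DirProd_group isoA] gA1 by simp
    ultimately show ?thesis
      using isoB[folded same_exp] by - (rule iso_trans[OF iso_trans])
  qed
qed

lemma (in group) torsion_count_conv_ord: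
  assumes "finite (carrier G)" "d > 0"
  shows "torsion_count G d = (\<Sum>e | e dvd d. card {x \<in> carrier G. ord x = e})"
proof -
  have "{x \<in> carrier G. x [^] d = \<one>} = (\<Union>e\<in>{e. e dvd d}. {x \<in> carrier G. ord x = e})"
    by (auto simp: pow_eq_id)
  then show ?thesis
    unfolding torsion_count_def using assms
    by (simp, subst card_UN_disjoint) auto
qed

lemma abelian_p_groups_iso_if_same_orders:
  assumes p: "Factorial_Ring.prime p" and A: "comm_group A" and B: "comm_group B"
    and oA: "order A = p ^ n" and oB: "order B = p ^ n"
    and count: "\<And>m. 1 \<le> m \<Longrightarrow> m \<le> n \<Longrightarrow>
      card {a \<in> carrier A. group.ord A a = p ^ m} = card {b \<in> carrier B. group.ord B b = p ^ m}"
  shows "A \<cong> B"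
proof -
  interpret A: comm_group A by fact
  interpret B: comm_group B by fact
  have finA: "finite (carrier A)" and finB: "finite (carrier B)"
    using oA oB p A.order_gt_0_iff_finite B.order_gt_0_iff_finite prime_gt_0_nat by simp_all
  have ord_count: "card {a \<in> carrier A. A.ord a = e} = card {b \<in> carrier B. B.ord b = e}" for e
  proof (cases "\<exists>m\<le>n. e = p ^ m")
    case True
    then obtain m where m: "m \<le> n" "e = p ^ m" by blast
    show ?thesis
    proof (cases "m = 0")
      case True
      have "{a \<in> carrier A. A.ord a = 1} = {\<one>\<^bsub>A\<^esub>}" "{b \<in> carrier B. B.ord b = 1} = {\<one>\<^bsub>B\<^esub>}"
        using A.ord_eq_1 B.ord_eq_1 by auto
      then show ?thesis using m True by simp
    next
      case False
      then show ?thesis using count[of m] m by simp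
    qed
  next
    case False
    have "{a \<in> carrier A. A.ord a = e} = {}" "{b \<in> carrier B. B.ord b = e} = {}"
      using False A.ord_dvd_group_order B.ord_dvd_group_order p
      by (auto simp: oA oB divides_primepow_nat)
    then show ?thesis by (simp only: card.empty)
  qed
  have "torsion_count A d = torsion_count B d" for d
  proof (cases "d = 0")
    case True
    then show ?thesis
      using oA oB by (simp add: torsion_count_def order_def)
  next
    case False
    then show ?thesis
      using A.torsion_count_conv_ord[OF finA] B.torsion_count_conv_ord[OF finB] ord_count by simp
  qed
  then show ?thesis
    using abelian_p_groups_iso[OF p A B oA oB] by blast
qed

section \<open>Realizability passes to the abelian group\<close>

theorem theorem10:
  fixes p n :: nat
    and N :: "('n, 'x) monoid_scheme"
    and A :: "('a, 'y) monoid_scheme"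
    and G :: "('g, 'z) monoid_scheme"
    and G' :: "'g set"
  assumes "Factorial_Ring.prime p" and "odd p" and "n \<ge> 3"
    and "group N" and "order N = p ^ n" and "\<not> comm_group N"
    and "card (derived N (carrier N)) = p"
    and "comm_group A" and "order A = p ^ n"
    and "\<And>m. 1 \<le> m \<Longrightarrow> m \<le> n \<Longrightarrow>
           card {a \<in> carrier A. group.ord A a = p ^ m} = card {x \<in> carrier N. group.ord N x = p ^ m}"
    and "group G" and "subgroup G' G" and "card (rcosets\<^bsub>G\<^esub> G') = p ^ n"
    and "realizable G G' N"
  shows "realizable G G' A"
proof -
  define h where "h = (p + 1) div 2"
  have h: "2 * h = p + 1"
    using \<open>odd p\<close> by (simp add: h_def)
  interpret N: halvable_class_two N h
    by (rule halvable_class_two_if_derived_prime[OF _ _ _ _ h]) fact+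
  interpret A: comm_group A by fact
  have "realizable G G' N.B"
  proof (rule realizable_mono)
    show "realizable G G' N" by fact
    show "group N.B" using N.comm_group_baer by (simp add: comm_group_def)
    show "carrier (Hol N) \<subseteq> carrier (Hol N.B)" by (rule N.Hol_subset_Hol_baer)
  qed simp_all
  moreover have "N.B \<cong> A"
  proof (rule abelian_p_groups_iso_if_same_orders)
    show "Factorial_Ring.prime p" "comm_group N.B" "comm_group A" "order A = p ^ n"
      by (fact, rule N.comm_group_baer, fact, fact)
    show "order N.B = p ^ n"
      using \<open>order N = p ^ n\<close> by (simp add: order_def)
    fix m assume m: "1 \<le> m" "m \<le> n"
    have "{b \<in> carrier N.B. group.ord N.B b = p ^ m} = {x \<in> carrier N. N.ord x = p ^ m}"
      by (auto simp: N.ord_baer)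
    with assms(10)[OF m] show "card {b \<in> carrier N.B. group.ord N.B b = p ^ m} =
        card {a \<in> carrier A. A.ord a = p ^ m}"
      by simp
  qed
  ultimately show ?thesis
    by (rule realizable_iso[OF _ A.group_axioms])
qed

end
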